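(* Let $\alpha,\beta\in\mathbb{C}$ be nonzero with $|\alpha|^2+|\beta|^2=1$. If $\mathcal{M}\subseteq H^2_{\alpha,\beta}$ is a nonzero closed subspace with $S_{\alpha,\beta}\mathcal{M}\subseteq\mathcal{M}$, then $$\dim(\mathcal{M}\ominus S_{\alpha,\beta}\mathcal{M})=1.$$
   Context: $H^2(\mathbb{D})$ is the Hardy space of the open unit disc. Let $H^2_{\alpha,\beta}=\overline{\mathrm{span}}\{\alpha+\beta z,\ z^n: n\ge 2\}$, a closed subspace of $H^2(\mathbb{D})$. Let $P_{H^2_{\alpha,\beta}}$ be the orthogonal projection of $H^2(\mathbb{D})$ onto $H^2_{\alpha,\beta}$, $M_z$ multiplication by $z$ on $H^2(\mathbb{D})$, and $S_{\alpha,\beta}=P_{H^2_{\alpha,\beta}}M_z|_{H^2_{\alpha,\beta}}$. $\mathcal{M}\ominus\mathcal{N}$ denotes the orthogonal complement of $\mathcal{N}$ in $\mathcal{M}$. *)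

theory Defs
  imports "HOL-Complex_Analysis.Complex_Analysis"
begin

abbreviation taylor :: "(complex \<Rightarrow> complex) \<Rightarrow> nat \<Rightarrow> complex"
  where "taylor f \<equiv> fps_nth (fps_expansion f 0)"

text \<open>
  HOL functions are total, so a function on the open unit disc is represented by its
  extension by zero; this makes equality of the representatives agree with equality on the disc.
  \<open>H\<^sup>2\<close> is taken in its Taylor-coefficient form, with inner product
  \<open>\<Sum> a\<^sub>n * cnj b\<^sub>n\<close> (linear in the first argument).
\<close>
definition hardy_set :: "(complex \<Rightarrow> complex) set"
  where "hardy_set = {f. f holomorphic_on ball 0 1 \<and> (\<forall>z. z \<notin> ball 0 1 \<longrightarrow> f z = 0) \<and>
                         summable (\<lambda>n. (cmod (taylor f n))\<^sup>2)}"

lemma hardy_setD: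
  assumes "f \<in> hardy_set"
  shows "f holomorphic_on ball 0 1" "\<And>z. z \<notin> ball 0 1 \<Longrightarrow> f z = 0"
    "summable (\<lambda>n. (cmod (taylor f n))\<^sup>2)" "f has_fps_expansion fps_expansion f 0"
proof -
  show 1: "f holomorphic_on ball 0 1" "\<And>z. z \<notin> ball 0 1 \<Longrightarrow> f z = 0"
    "summable (\<lambda>n. (cmod (taylor f n))\<^sup>2)"
    using assms by (auto simp: hardy_set_def)
  show "f has_fps_expansion fps_expansion f 0"
    by (rule has_fps_expansion_fps_expansion[OF _ _ 1(1)]) auto
qed

lemma hardy_setI:
  assumes "f holomorphic_on ball 0 1" "\<And>z. z \<notin> ball 0 1 \<Longrightarrow> f z = 0"
    "f has_fps_expansion F" "summable (\<lambda>n. (cmod (fps_nth F n))\<^sup>2)"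
  shows "f \<in> hardy_set"
  using assms by (auto simp: hardy_set_def fps_expansion_eqI)

lemma summable_square_add:
  fixes a b :: "nat \<Rightarrow> complex"
  assumes "summable (\<lambda>n. (cmod (a n))\<^sup>2)" "summable (\<lambda>n. (cmod (b n))\<^sup>2)"
  shows "summable (\<lambda>n. (cmod (a n + b n))\<^sup>2)"
proof (rule summable_comparison_test')
  show "summable (\<lambda>n. 2 * (cmod (a n))\<^sup>2 + 2 * (cmod (b n))\<^sup>2)"
    using assms by (intro summable_add summable_mult)
next
  fix n :: nat
  have "(cmod (a n + b n))\<^sup>2 \<le> (cmod (a n) + cmod (b n))\<^sup>2"
    by (intro power_mono norm_triangle_ineq) auto
  also have "\<dots> \<le> 2 * (cmod (a n))\<^sup>2 + 2 * (cmod (b n))\<^sup>2"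
    using sum_squares_bound[of "cmod (a n)" "cmod (b n)"] by (simp add: power2_sum)
  finally show "norm ((cmod (a n + b n))\<^sup>2) \<le> 2 * (cmod (a n))\<^sup>2 + 2 * (cmod (b n))\<^sup>2"
    by simp
qed

lemma summable_square_mult:
  fixes a b :: "nat \<Rightarrow> complex"
  assumes "summable (\<lambda>n. (cmod (a n))\<^sup>2)" "summable (\<lambda>n. (cmod (b n))\<^sup>2)"
  shows "summable (\<lambda>n. a n * cnj (b n))"
proof (rule summable_comparison_test')
  show "summable (\<lambda>n. (cmod (a n))\<^sup>2 + (cmod (b n))\<^sup>2)"
    using assms by (intro summable_add)
next
  fix n :: nat
  have "2 * (cmod (a n) * cmod (b n)) \<le> (cmod (a n))\<^sup>2 + (cmod (b n))\<^sup>2"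
    using sum_squares_bound[of "cmod (a n)" "cmod (b n)"] by simp
  moreover have "0 \<le> cmod (a n) * cmod (b n)" by simp
  ultimately show "norm (a n * cnj (b n)) \<le> (cmod (a n))\<^sup>2 + (cmod (b n))\<^sup>2"
    unfolding norm_mult complex_mod_cnj by linarith
qed

lemma zero_in_hardy_set: "(\<lambda>z. 0) \<in> hardy_set"
  by (rule hardy_setI[where F = 0]) auto

lemma add_in_hardy_set:
  assumes "f \<in> hardy_set" "g \<in> hardy_set"
  shows "(\<lambda>z. f z + g z) \<in> hardy_set"
  using hardy_setD[OF assms(1)] hardy_setD[OF assms(2)]
  by (intro hardy_setI[where F = "fps_expansion f 0 + fps_expansion g 0"])
     (auto intro!: holomorphic_intros has_fps_expansion_add summable_square_add)

lemma scale_in_hardy_set: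
  assumes "f \<in> hardy_set"
  shows "(\<lambda>z. c * f z) \<in> hardy_set"
  using hardy_setD[OF assms]
  by (intro hardy_setI[where F = "fps_const c * fps_expansion f 0"])
     (auto intro!: holomorphic_intros has_fps_expansion_cmult_left summable_mult
           simp: norm_mult power_mult_distrib)

lemma times_z_in_hardy_set:
  assumes "f \<in> hardy_set"
  shows "(\<lambda>z. z * f z) \<in> hardy_set"
proof (rule hardy_setI[where F = "fps_X * fps_expansion f 0"])
  have "summable (\<lambda>n. (cmod (fps_nth (fps_X * fps_expansion f 0) (Suc n)))\<^sup>2)"
    using hardy_setD[OF assms] by simp
  thus "summable (\<lambda>n. (cmod (fps_nth (fps_X * fps_expansion f 0) n))\<^sup>2)"
    by (subst (asm) summable_Suc_iff)
qed (use hardy_setD[OF assms] in \<open>auto intro!: holomorphic_intros fps_expansion_intros\<close>)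

lemma monom_in_hardy_set: "(\<lambda>z. if z \<in> ball 0 1 then z ^ n else 0) \<in> hardy_set"
proof (rule hardy_setI[where F = "fps_X ^ n"])
  show "(\<lambda>z. if z \<in> ball 0 1 then z ^ n else 0) holomorphic_on ball 0 1"
    by (rule holomorphic_transform[of "\<lambda>z. z ^ n"]) (auto intro!: holomorphic_intros)
  have "eventually (\<lambda>z::complex. z \<in> ball 0 1) (nhds 0)"
    by (intro eventually_nhds_in_open) auto
  hence "eventually (\<lambda>z::complex. (if z \<in> ball 0 1 then z ^ n else 0) = z ^ n) (nhds 0)"
    by eventually_elim auto
  thus "(\<lambda>z::complex. if z \<in> ball 0 1 then z ^ n else 0) has_fps_expansion fps_X ^ n"
    by (subst has_fps_expansion_cong[OF _ refl]) (auto intro: fps_expansion_intros)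
  show "summable (\<lambda>k. (cmod (fps_nth (fps_X ^ n) k))\<^sup>2)"
    by (rule summable_finite[of "{n}"]) auto
qed auto

typedef hardy = hardy_set
  morphisms hardy_fun Abs_hardy
  using zero_in_hardy_set by blast

setup_lifting type_definition_hardy

lift_definition hardy_monom :: "nat \<Rightarrow> hardy"
  is "\<lambda>n z. if z \<in> ball 0 1 then z ^ n else 0"
  by (rule monom_in_hardy_set)

lift_definition hardy_scale :: "complex \<Rightarrow> hardy \<Rightarrow> hardy"  (infixr "*\<^sub>H" 75)
  is "\<lambda>c f z. c * f z"
  by (rule scale_in_hardy_set)

lift_definition hardy_Mz :: "hardy \<Rightarrow> hardy"
  is "\<lambda>f z. z * f z"
  by (rule times_z_in_hardy_set)

definition hcoeff :: "hardy \<Rightarrow> nat \<Rightarrow> complex"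
  where "hcoeff f = taylor (hardy_fun f)"

definition hinner :: "hardy \<Rightarrow> hardy \<Rightarrow> complex"
  where "hinner f g = (\<Sum>n. hcoeff f n * cnj (hcoeff g n))"

instantiation hardy :: ab_group_add
begin

lift_definition zero_hardy :: hardy is "\<lambda>z. 0"
  by (rule zero_in_hardy_set)

lift_definition plus_hardy :: "hardy \<Rightarrow> hardy \<Rightarrow> hardy" is "\<lambda>f g z. f z + g z"
  by (rule add_in_hardy_set)

lift_definition uminus_hardy :: "hardy \<Rightarrow> hardy" is "\<lambda>f z. - f z"
  using scale_in_hardy_set[where c = "-1"] by simp

lift_definition minus_hardy :: "hardy \<Rightarrow> hardy \<Rightarrow> hardy" is "\<lambda>f g z. f z - g z"
  using add_in_hardy_set scale_in_hardy_set[where c = "-1"] by fastforce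

instance
  by standard (transfer; simp add: fun_eq_iff algebra_simps)+

end

interpretation hardy: vector_space hardy_scale
  by standard (transfer; simp add: fun_eq_iff algebra_simps)+

lemma summable_hcoeff: "summable (\<lambda>n. (cmod (hcoeff f n))\<^sup>2)"
  unfolding hcoeff_def using hardy_setD(3)[OF hardy_fun] .

lemma summable_hinner: "summable (\<lambda>n. hcoeff f n * cnj (hcoeff g n))"
  by (intro summable_square_mult summable_hcoeff)

lemma hardy_fun_has_fps_expansion: "hardy_fun f has_fps_expansion Abs_fps (hcoeff f)"
  using hardy_setD(4)[OF hardy_fun[of f]] by (simp add: hcoeff_def fps_nth_inverse)

lemma hcoeff_eqI: "hardy_fun f has_fps_expansion F \<Longrightarrow> hcoeff f = fps_nth F"
  by (simp add: hcoeff_def fps_expansion_eqI)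

lemma hcoeff_add: "hcoeff (f + g) n = hcoeff f n + hcoeff g n"
  using hcoeff_eqI[of "f + g" "Abs_fps (hcoeff f) + Abs_fps (hcoeff g)"]
    has_fps_expansion_add[OF hardy_fun_has_fps_expansion hardy_fun_has_fps_expansion, of f g]
  by (simp add: plus_hardy.rep_eq)

lemma hcoeff_scale: "hcoeff (c *\<^sub>H f) n = c * hcoeff f n"
  using hcoeff_eqI[of "c *\<^sub>H f" "fps_const c * Abs_fps (hcoeff f)"]
    has_fps_expansion_cmult_left[OF hardy_fun_has_fps_expansion, of c f]
  by (simp add: hardy_scale.rep_eq)

lemma hcoeff_eq_zero_imp:
  assumes "\<And>n. hcoeff f n = 0"
  shows "f = 0"
proof -
  have "hardy_fun f z = 0" for z
  proof (cases "z \<in> ball 0 1")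
    case True
    have "(\<lambda>n. fps_nth (Abs_fps (hcoeff f)) n * z ^ n) sums hardy_fun f z"
      by (rule has_fps_expansion_imp_sums_complex[OF hardy_fun_has_fps_expansion, where r = 1])
         (use True hardy_setD(1)[OF hardy_fun[of f]] in \<open>auto simp flip: one_ereal_def\<close>)
    thus ?thesis
      using assms by (simp add: sums_iff)
  qed (use hardy_setD(2)[OF hardy_fun[of f]] in auto)
  thus ?thesis
    by transfer auto
qed

lemma hinner_commute: "hinner g f = cnj (hinner f g)"
proof -
  have "(\<lambda>n. hcoeff f n * cnj (hcoeff g n)) sums hinner f g"
    unfolding hinner_def by (intro summable_sums summable_hinner)
  hence "(\<lambda>n. cnj (hcoeff f n * cnj (hcoeff g n))) sums cnj (hinner f g)"
    by (subst sums_cnj)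
  thus ?thesis
    unfolding hinner_def[of g f] by (simp add: sums_iff mult.commute)
qed

lemma hinner_add_left: "hinner (f + g) h = hinner f h + hinner g h"
  unfolding hinner_def using summable_hinner
  by (subst suminf_add) (auto simp: hcoeff_add algebra_simps)

lemma hinner_scale_left: "hinner (c *\<^sub>H f) g = c * hinner f g"
  unfolding hinner_def using summable_hinner
  by (subst suminf_mult[symmetric]) (auto simp: hcoeff_scale algebra_simps)

lemma hinner_same: "hinner f f = of_real (\<Sum>n. (cmod (hcoeff f n))\<^sup>2)"
  unfolding hinner_def
  by (subst suminf_of_real[OF summable_hcoeff]) (simp only: complex_norm_square)

lemma hinner_same_eq_zero_iff: "hinner f f = 0 \<longleftrightarrow> f = 0"
proof
  assume "hinner f f = 0"
  hence "(\<Sum>n. (cmod (hcoeff f n))\<^sup>2) = 0"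
    unfolding hinner_same by (simp only: of_real_eq_0_iff)
  hence "\<forall>n. (cmod (hcoeff f n))\<^sup>2 = 0"
    by (subst (asm) suminf_eq_zero_iff[OF summable_hcoeff]) auto
  thus "f = 0" by (intro hcoeff_eq_zero_imp) auto
next
  assume "f = 0"
  thus "hinner f f = 0"
    using hinner_add_left[of 0 0 0] by simp
qed

text \<open>
  The real structure underlying the complex Hilbert space supplies the norm and the topology:
  \<^term>\<open>norm f\<close> is the square root of \<^term>\<open>hinner f f\<close>.
\<close>
instantiation hardy :: real_inner
begin

definition scaleR_hardy :: "real \<Rightarrow> hardy \<Rightarrow> hardy"
  where "scaleR_hardy r f = complex_of_real r *\<^sub>H f"

definition inner_hardy :: "hardy \<Rightarrow> hardy \<Rightarrow> real"
  where "inner_hardy f g = Re (hinner f g)"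

definition norm_hardy :: "hardy \<Rightarrow> real"
  where "norm_hardy f = sqrt (Re (hinner f f))"

definition sgn_hardy :: "hardy \<Rightarrow> hardy"
  where "sgn_hardy f = inverse (norm f) *\<^sub>R f"

definition dist_hardy :: "hardy \<Rightarrow> hardy \<Rightarrow> real"
  where "dist_hardy f g = norm (f - g)"

definition uniformity_hardy :: "(hardy \<times> hardy) filter"
  where "uniformity_hardy = (INF e\<in>{0<..}. principal {(f, g). dist f g < e})"

definition open_hardy :: "hardy set \<Rightarrow> bool"
  where "open_hardy U \<longleftrightarrow> (\<forall>f\<in>U. \<forall>\<^sub>F (f', g) in uniformity. f' = f \<longrightarrow> g \<in> U)"

instance
proof
  fix f g h :: hardy and r s :: real
  show "r *\<^sub>R (f + g) = r *\<^sub>R f + r *\<^sub>R g" "(r + s) *\<^sub>R f = r *\<^sub>R f + s *\<^sub>R f"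
    "r *\<^sub>R s *\<^sub>R f = (r * s) *\<^sub>R f" "1 *\<^sub>R f = f"
    by (simp_all add: scaleR_hardy_def hardy.scale_right_distrib hardy.scale_left_distrib)
  show "f \<bullet> g = g \<bullet> f"
    using hinner_commute[of f g] by (simp add: inner_hardy_def)
  show "(f + g) \<bullet> h = f \<bullet> h + g \<bullet> h"
    by (simp add: inner_hardy_def hinner_add_left)
  show "(r *\<^sub>R f) \<bullet> g = r * (f \<bullet> g)"
    by (simp add: inner_hardy_def scaleR_hardy_def hinner_scale_left)
  show "0 \<le> f \<bullet> f"
    by (simp add: inner_hardy_def hinner_same suminf_nonneg[OF summable_hcoeff])
  show "f \<bullet> f = 0 \<longleftrightarrow> f = 0"
    by (simp add: inner_hardy_def hinner_same complex_eq_iff flip: hinner_same_eq_zero_iff)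
  show "norm f = sqrt (f \<bullet> f)"
    by (simp add: inner_hardy_def norm_hardy_def)
qed (simp_all add: sgn_hardy_def dist_hardy_def uniformity_hardy_def open_hardy_def)

end

definition hardy_ominus :: "hardy set \<Rightarrow> hardy set \<Rightarrow> hardy set"  (infixl "\<ominus>\<^sub>H" 65)
  where "M \<ominus>\<^sub>H N = {f \<in> M. \<forall>g\<in>N. hinner f g = 0}"

text \<open>Meaningful for closed subspaces \<^term>\<open>V\<close>, where the described element exists and is unique.\<close>
definition hardy_proj :: "hardy set \<Rightarrow> hardy \<Rightarrow> hardy"
  where "hardy_proj V f = (THE g. g \<in> V \<and> (\<forall>h\<in>V. hinner (f - g) h = 0))"

definition H2_ab :: "complex \<Rightarrow> complex \<Rightarrow> hardy set"
  where "H2_ab \<alpha> \<beta> = closure (hardy.span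
     (insert (\<alpha> *\<^sub>H hardy_monom 0 + \<beta> *\<^sub>H hardy_monom 1) {hardy_monom n | n. n \<ge> 2}))"

text \<open>Only the values on \<^term>\<open>H2_ab \<alpha> \<beta>\<close> matter; there it is the compression of the shift.\<close>
definition S_ab :: "complex \<Rightarrow> complex \<Rightarrow> hardy \<Rightarrow> hardy"
  where "S_ab \<alpha> \<beta> f = hardy_proj (H2_ab \<alpha> \<beta>) (hardy_Mz f)"

end

theory Submission
  imports Defs
begin

text \<open>
  The operator \<open>S\<close> is similar to the shift, so the theorem reduces to the fact that a nonzero
  closed subspace \<open>N\<close> of \<open>H\<^sup>2\<close> with \<open>z N \<subseteq> N\<close> satisfies \<open>dim (N / z N) = 1\<close>.

  With \<open>\<lambda> = \<alpha> * cnj \<beta>\<close> one has \<open>S (\<alpha> + \<beta> z) = \<lambda> (\<alpha> + \<beta> z) + \<beta> z\<^sup>2\<close> and \<open>S z\<^sup>n = z\<^bsup>n+1\<^esup>\<close> for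
  \<open>n \<ge> 2\<close>. The functional \<open>c (\<alpha> + \<beta> z) + z\<^sup>2 h \<mapsto> c \<beta> / (w - \<lambda>) + h(w)\<close> is therefore, for
  \<open>\<bar>w\<bar> < 1\<close> and \<open>w \<noteq> \<lambda>\<close>, an eigenvector of the transpose of \<open>S\<close> for the eigenvalue \<open>w\<close>.
  Clearing the denominator gives the map
  \<open>T (c (\<alpha> + \<beta> z) + z\<^sup>2 h) = c \<beta> + (z - \<lambda>) h\<close>, which satisfies \<open>T (S f) = z T f\<close>. In terms of
  the backward shift \<open>B\<close> it is \<open>T = B - \<lambda> B\<^sup>2 = (I - \<lambda> B) B\<close>. It is bounded below on \<open>H2_ab\<close>: the
  factor \<open>I - \<lambda> B\<close> because \<open>\<bar>\<lambda>\<bar> < 1\<close>, and \<open>B\<close> because on \<open>H2_ab\<close> the constant coefficient is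
  \<open>\<alpha> / \<beta>\<close> times the next one (\<open>shift_intertwiner_S_ab\<close>, \<open>norm_le_shift_intertwiner\<close>).
  Hence \<open>N = T M\<close> is closed and shift invariant, \<open>T (S M) = z N\<close>, and \<open>S M = M \<inter> T\<^sup>-\<^sup>1 (z N)\<close> is
  closed, so that the codimension of \<open>S M\<close> in \<open>M\<close> can be read off from its orthogonal complement
  (\<open>dim_orthogonal_complement_eq_1\<close>).

  The statement about \<open>N\<close> is the essential part of Beurling's theorem
  (\<open>shift_invariant_decomposition\<close>), and it is obtained without boundary values. For \<open>f\<close> in
  \<open>N \<ominus> z N\<close> the functions \<open>z\<^sup>k f\<close> are pairwise orthogonal and of equal norm, so
  \<open>\<parallel>g f\<parallel> = \<parallel>g\<parallel> \<parallel>f\<parallel>\<close> for all \<open>g\<close> in \<open>H\<^sup>2\<close> (\<open>wandering_product\<close>). Two orthogonal elements of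
  \<open>N \<ominus> z N\<close> that are both nonzero would then contradict the parallelogram law, applied to their
  squares (\<open>wandering_orthogonal_imp_zero\<close>).
\<close>

section \<open>Coefficients, norm and multiplication by z\<close>

lemma hcoeff_zero [simp]: "hcoeff 0 n = 0"
  using hcoeff_add[of 0 0 n] by simp

lemma hcoeff_uminus: "hcoeff (- f) n = - hcoeff f n"
  using hcoeff_add[of f "- f" n] by (simp add: eq_neg_iff_add_eq_0 add.commute)

lemma hcoeff_diff: "hcoeff (f - g) n = hcoeff f n - hcoeff g n"
  using hcoeff_add[of f "- g" n] by (simp add: hcoeff_uminus)

lemma hardy_eqI: "(\<And>n. hcoeff f n = hcoeff g n) \<Longrightarrow> f = g"
  using hcoeff_eq_zero_imp[of "f - g"] by (simp add: hcoeff_diff)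

lemma hcoeff_scaleR: "hcoeff (r *\<^sub>R f) n = of_real r * hcoeff f n"
  by (simp add: scaleR_hardy_def hcoeff_scale)

lemma hcoeff_Mz: "hcoeff (hardy_Mz f) n = (case n of 0 \<Rightarrow> 0 | Suc m \<Rightarrow> hcoeff f m)"
  using hcoeff_eqI[of "hardy_Mz f" "fps_X * Abs_fps (hcoeff f)"]
    has_fps_expansion_mult[OF has_fps_expansion_fps_X hardy_fun_has_fps_expansion, of f]
  by (simp add: hardy_Mz.rep_eq fps_X_mult_nth split: nat.splits)

lemma hcoeff_monom: "hcoeff (hardy_monom m) n = (if n = m then 1 else 0)"
proof -
  have "eventually (\<lambda>z::complex. z \<in> ball 0 1) (nhds 0)"
    by (intro eventually_nhds_in_open) auto
  hence "eventually (\<lambda>z::complex. (if z \<in> ball 0 1 then z ^ m else 0) = z ^ m) (nhds 0)"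
    by eventually_elim auto
  hence "hardy_fun (hardy_monom m) has_fps_expansion fps_X ^ m"
    unfolding hardy_monom.rep_eq
    by (subst has_fps_expansion_cong[OF _ refl]) (auto intro: fps_expansion_intros)
  thus ?thesis by (simp add: hcoeff_eqI)
qed

lemma norm_hardy_square: "(norm f)\<^sup>2 = (\<Sum>n. (cmod (hcoeff f n))\<^sup>2)"
  by (simp add: norm_hardy_def hinner_same suminf_nonneg[OF summable_hcoeff])

lemma sum_hcoeff_le_norm_square:
  "finite A \<Longrightarrow> (\<Sum>n\<in>A. (cmod (hcoeff f n))\<^sup>2) \<le> (norm f)\<^sup>2"
  unfolding norm_hardy_square by (rule sum_le_suminf[OF summable_hcoeff]) auto

lemma cmod_hcoeff_le_norm: "cmod (hcoeff f n) \<le> norm f"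
  using sum_hcoeff_le_norm_square[of "{n}" f] by (simp add: power2_le_iff_abs_le)

lemma norm_hardy_le:
  assumes "\<And>N. (\<Sum>n<N. (cmod (hcoeff f n))\<^sup>2) \<le> c\<^sup>2" "0 \<le> c"
  shows "norm f \<le> c"
proof -
  have "(norm f)\<^sup>2 \<le> c\<^sup>2"
    unfolding norm_hardy_square by (rule suminf_le_const[OF summable_hcoeff]) (use assms in auto)
  thus ?thesis using assms(2) by (simp add: power2_le_iff_abs_le)
qed

lemma bounded_linear_hcoeff: "bounded_linear (\<lambda>f. hcoeff f n)"
  by (rule bounded_linear_intro[where K = 1])
     (auto simp: hcoeff_add hcoeff_scaleR cmod_hcoeff_le_norm scaleR_conv_of_real)

lemma norm_hardy_scale: "norm (c *\<^sub>H f) = cmod c * norm f"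
proof -
  have "(norm (c *\<^sub>H f))\<^sup>2 = (cmod c)\<^sup>2 * (norm f)\<^sup>2"
    unfolding norm_hardy_square hcoeff_scale norm_mult power_mult_distrib
    by (rule suminf_mult[OF summable_hcoeff])
  thus ?thesis by (simp flip: power_mult_distrib)
qed

lemma bounded_linear_hardy_scale: "bounded_linear ((*\<^sub>H) c)"
  by (rule bounded_linear_intro[where K = "cmod c"])
     (auto simp: norm_hardy_scale scaleR_hardy_def hardy.scale_right_distrib mult.commute)

lemma hinner_zero_left [simp]: "hinner 0 g = 0"
  using hinner_add_left[of 0 0 g] by simp

lemma hinner_diff_left: "hinner (f - g) h = hinner f h - hinner g h"
  using hinner_add_left[of "f - g" g h] by simp

lemma hinner_add_right: "hinner f (g + h) = hinner f g + hinner f h"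
  by (simp add: hinner_commute[of f] hinner_add_left)

lemma hinner_scale_right: "hinner f (c *\<^sub>H g) = cnj c * hinner f g"
  by (simp add: hinner_commute[of f] hinner_scale_left)

lemma hinner_monom: "hinner f (hardy_monom n) = hcoeff f n"
  unfolding hinner_def by (subst suminf_finite[of "{n}"]) (auto simp: hcoeff_monom)

lemma hinner_Mz: "hinner (hardy_Mz f) (hardy_Mz g) = hinner f g"
  using suminf_split_head[OF summable_hinner[of "hardy_Mz f" "hardy_Mz g"]]
  by (simp add: hinner_def hcoeff_Mz)

lemma norm_hardy_Mz: "norm (hardy_Mz f) = norm f"
  by (simp add: norm_hardy_def hinner_Mz)

lemma bounded_linear_hardy_Mz: "bounded_linear hardy_Mz"
  by (rule bounded_linear_intro[where K = 1])
     (auto simp: norm_hardy_Mz hcoeff_Mz hcoeff_add hcoeff_scaleR intro!: hardy_eqI split: nat.splits)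

lemma hardy_Mz_scale: "hardy_Mz (c *\<^sub>H f) = c *\<^sub>H hardy_Mz f"
  by (rule hardy_eqI) (simp add: hcoeff_Mz hcoeff_scale split: nat.splits)

section \<open>Completeness of the Hardy space\<close>

text \<open>
  By the Cauchy--Schwarz inequality against a geometric series, the power series of a square
  summable sequence converges on the unit disc; the function is then extended by zero.
\<close>
lemma ex_hardy_hcoeff:
  assumes "summable (\<lambda>n. (cmod (a n))\<^sup>2)"
  shows "\<exists>f. hcoeff f = a"
proof -
  define F where "F = Abs_fps a"
  have "summable (\<lambda>n. a n * of_real r ^ n)" if "0 < r" "r < 1" for r
  proof -
    have "summable (\<lambda>n. (r\<^sup>2) ^ n)"
      using that by (intro summable_geometric) (simp add: power_less_one_iff)
    hence "summable (\<lambda>n. (cmod (of_real r ^ n))\<^sup>2)"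
      using that by (simp add: norm_power flip: power_mult) (simp add: mult.commute)
    from summable_square_mult[OF assms this] show ?thesis by simp
  qed
  hence R: "fps_conv_radius F \<ge> 1"
    unfolding fps_conv_radius_def F_def fps_nth_Abs_fps
    by (intro conv_radius_geI_ex') (auto simp: one_ereal_def)
  have less: "ereal (cmod z) < fps_conv_radius F" if "cmod z < 1" for z
    using that by (intro less_le_trans[OF _ R]) (simp add: one_ereal_def)
  define f where "f = (\<lambda>z. if z \<in> ball 0 1 then eval_fps F z else 0)"
  have "eval_fps F holomorphic_on ball 0 1"
    by (rule holomorphic_on_eval_fps) (use less in auto)
  hence hol: "f holomorphic_on ball 0 1"
    by (rule holomorphic_transform) (auto simp: f_def)
  have "eventually (\<lambda>z::complex. z \<in> ball 0 1) (nhds 0)"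
    by (intro eventually_nhds_in_open) auto
  hence ev: "eventually (\<lambda>z::complex. f z = eval_fps F z) (nhds 0)"
    by eventually_elim (auto simp: f_def)
  have "eval_fps F has_fps_expansion F"
    by (rule eval_fps_has_fps_expansion) (use less[of 0] in \<open>simp add: zero_ereal_def\<close>)
  hence exp: "f has_fps_expansion F"
    by (subst has_fps_expansion_cong[OF ev refl])
  have "f \<in> hardy_set"
    by (rule hardy_setI[OF hol _ exp]) (use assms in \<open>auto simp: f_def F_def\<close>)
  hence "hardy_fun (Abs_hardy f) = f"
    by (simp add: Abs_hardy_inverse)
  with exp have "hcoeff (Abs_hardy f) = a"
    using hcoeff_eqI[of "Abs_hardy f" F] by (auto simp: F_def)
  thus ?thesis ..
qed

text \<open>
  As for \<open>\<ell>\<^sup>2\<close>: a Cauchy sequence converges in each coefficient, and its finite square sums pass to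
  the limit, so that the limit sequence is square summable and is the limit in norm.
\<close>
instance hardy :: complete_space
proof
  fix X :: "nat \<Rightarrow> hardy" assume X: "Cauchy X"
  have "Cauchy (\<lambda>m. hcoeff (X m) n)" for n
    using bounded_linear.Cauchy[OF bounded_linear_hcoeff X] .
  hence "convergent (\<lambda>m. hcoeff (X m) n)" for n
    by (simp add: Cauchy_convergent_iff)
  then obtain a where a: "(\<lambda>m. hcoeff (X m) n) \<longlonglongrightarrow> a n" for n
    unfolding convergent_def by metis
  have tail: "\<exists>K. \<forall>m\<ge>K. \<forall>N. (\<Sum>n<N. (cmod (hcoeff (X m) n - a n))\<^sup>2) \<le> e\<^sup>2"
    if e: "e > 0" for e
  proof -
    obtain K where K: "\<And>m k. m \<ge> K \<Longrightarrow> k \<ge> K \<Longrightarrow> norm (X m - X k) < e"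
      using CauchyD[OF X e] by blast
    have "(\<Sum>n<N. (cmod (hcoeff (X m) n - a n))\<^sup>2) \<le> e\<^sup>2" if "m \<ge> K" for m N
    proof (rule tendsto_upperbound)
      show "(\<lambda>k. \<Sum>n<N. (cmod (hcoeff (X m) n - hcoeff (X k) n))\<^sup>2)
              \<longlonglongrightarrow> (\<Sum>n<N. (cmod (hcoeff (X m) n - a n))\<^sup>2)"
        by (intro tendsto_intros a)
      show "\<forall>\<^sub>F k in sequentially.
              (\<Sum>n<N. (cmod (hcoeff (X m) n - hcoeff (X k) n))\<^sup>2) \<le> e\<^sup>2"
      proof (rule eventually_sequentiallyI)
        fix k assume "k \<ge> K"
        have "(\<Sum>n<N. (cmod (hcoeff (X m - X k) n))\<^sup>2) \<le> (norm (X m - X k))\<^sup>2"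
          by (rule sum_hcoeff_le_norm_square) auto
        also have "\<dots> \<le> e\<^sup>2"
          using K[OF \<open>m \<ge> K\<close> \<open>k \<ge> K\<close>] by (intro power_mono) auto
        finally show "(\<Sum>n<N. (cmod (hcoeff (X m) n - hcoeff (X k) n))\<^sup>2) \<le> e\<^sup>2"
          by (simp add: hcoeff_diff)
      qed
    qed auto
    thus ?thesis by blast
  qed
  obtain K where K: "\<And>N. (\<Sum>n<N. (cmod (hcoeff (X K) n - a n))\<^sup>2) \<le> 1\<^sup>2"
    using tail[of 1] by auto
  have "summable (\<lambda>n. (cmod (hcoeff (X K) n - a n))\<^sup>2)"
    using K by (intro bounded_imp_summable[where B = 1]) (auto simp: lessThan_Suc_atMost[symmetric] simp del: sum.lessThan_Suc)
  hence "summable (\<lambda>n. (cmod (a n - hcoeff (X K) n))\<^sup>2)"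
    by (simp add: norm_minus_commute)
  from summable_square_add[OF this summable_hcoeff[of "X K"]]
  obtain f where f: "hcoeff f = a"
    using ex_hardy_hcoeff[of a] by auto
  have "X \<longlonglongrightarrow> f"
  proof (rule LIMSEQ_I)
    fix e :: real assume "e > 0"
    then obtain K where K: "\<forall>m\<ge>K. \<forall>N. (\<Sum>n<N. (cmod (hcoeff (X m) n - a n))\<^sup>2) \<le> (e / 2)\<^sup>2"
      using tail[of "e / 2"] by auto
    have "norm (X m - f) < e" if "m \<ge> K" for m
    proof -
      have "norm (X m - f) \<le> e / 2"
        by (rule norm_hardy_le) (use K that \<open>e > 0\<close> f in \<open>auto simp: hcoeff_diff\<close>)
      thus ?thesis using \<open>e > 0\<close> by simp
    qed
    thus "\<exists>K. \<forall>m\<ge>K. norm (X m - f) < e" by blast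
  qed
  thus "convergent X" by (auto simp: convergent_def)
qed

instance hardy :: banach ..

section \<open>Orthogonal projections\<close>

text \<open>
  The projection theorem. A sequence in \<open>V\<close> whose distances to \<open>x\<close> tend to the infimum is Cauchy by
  the parallelogram law; minimality of the distance at its limit \<open>p\<close> forces \<open>x - p\<close> to be
  orthogonal to \<open>V\<close>.
\<close>
lemma closed_subspace_orthogonal_projection:
  fixes V :: "'a :: {real_inner, complete_space} set"
  assumes V: "subspace V" "closed V"
  shows "\<exists>p\<in>V. \<forall>v\<in>V. inner (x - p) v = 0"
proof -
  define D where "D = (INF v\<in>V. (norm (x - v))\<^sup>2)"
  have bdd: "bdd_below ((\<lambda>v. (norm (x - v))\<^sup>2) ` V)"
    by (rule bdd_belowI2[where m = 0]) auto
  have D_le: "D \<le> (norm (x - v))\<^sup>2" if "v \<in> V" for v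
    unfolding D_def using bdd that by (rule cINF_lower)
  have "\<exists>v\<in>V. (norm (x - v))\<^sup>2 < D + inverse (of_nat (Suc n))" for n
    using cINF_less_iff[OF _ bdd, of "D + inverse (of_nat (Suc n))"] subspace_0[OF V(1)]
    by (auto simp: D_def[symmetric])
  then obtain y where yV: "\<And>n. y n \<in> V"
    and y: "\<And>n. (norm (x - y n))\<^sup>2 < D + inverse (of_nat (Suc n))"
    by metis
  have par: "(norm (u - v))\<^sup>2 \<le> 2 * ((norm (x - u))\<^sup>2 - D) + 2 * ((norm (x - v))\<^sup>2 - D)"
    if "u \<in> V" "v \<in> V" for u v
  proof -
    have "(1/2) *\<^sub>R (u + v) \<in> V"
      using that V(1) by (intro subspace_scale subspace_add)
    hence "D \<le> (norm (x - (1/2) *\<^sub>R (u + v)))\<^sup>2" by (rule D_le)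
    also have "\<dots> = (2 * (norm (x - u))\<^sup>2 + 2 * (norm (x - v))\<^sup>2 - (norm (u - v))\<^sup>2) / 4"
      by (simp add: power2_norm_eq_inner inner_diff_left inner_diff_right
            inner_add_left inner_add_right inner_commute field_simps)
    finally show ?thesis by simp
  qed
  have "Cauchy y"
  proof (rule CauchyI)
    fix e :: real assume "e > 0"
    then obtain N where N: "inverse (of_nat (Suc N)) < e\<^sup>2 / 4"
      using reals_Archimedean[of "e\<^sup>2 / 4"] by auto
    have "norm (y m - y n) < e" if "m \<ge> N" "n \<ge> N" for m n
    proof -
      have small: "(norm (x - y k))\<^sup>2 - D < e\<^sup>2 / 4" if "k \<ge> N" for k
      proof -
        have "inverse (of_nat (Suc k)) \<le> (inverse (of_nat (Suc N)) :: real)"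
          using that by (intro le_imp_inverse_le) auto
        thus ?thesis using y[of k] N by linarith
      qed
      have "(norm (y m - y n))\<^sup>2
              \<le> 2 * ((norm (x - y m))\<^sup>2 - D) + 2 * ((norm (x - y n))\<^sup>2 - D)"
        by (rule par[OF yV yV])
      also have "\<dots> < 2 * (e\<^sup>2 / 4) + 2 * (e\<^sup>2 / 4)"
        using small that by (intro add_strict_mono mult_strict_left_mono) auto
      finally have "(norm (y m - y n))\<^sup>2 < e\<^sup>2" by simp
      thus ?thesis using \<open>e > 0\<close> by (simp add: power2_less_imp_less)
    qed
    thus "\<exists>N. \<forall>m\<ge>N. \<forall>n\<ge>N. norm (y m - y n) < e" by blast
  qed
  then obtain p where p: "y \<longlonglongrightarrow> p"
    using Cauchy_convergent by (auto simp: convergent_def)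
  have pV: "p \<in> V"
    using closed_sequentially[OF V(2)] yV p by blast
  have "(norm (x - p))\<^sup>2 \<le> D + 0"
  proof (rule LIMSEQ_le)
    show "(\<lambda>n. (norm (x - y n))\<^sup>2) \<longlonglongrightarrow> (norm (x - p))\<^sup>2"
      by (intro tendsto_intros p)
    show "(\<lambda>n. D + inverse (of_nat (Suc n))) \<longlonglongrightarrow> D + 0"
      by (intro tendsto_intros LIMSEQ_inverse_real_of_nat)
  qed (use y in \<open>auto intro: less_imp_le\<close>)
  hence min: "(norm (x - p))\<^sup>2 \<le> (norm (x - v))\<^sup>2" if "v \<in> V" for v
    using D_le[OF that] by linarith
  have "inner (x - p) v = 0" if "v \<in> V" for v
  proof (cases "v = 0")
    case False
    \<comment> \<open>This \<open>t\<close> minimises \<open>\<parallel>x - p - t v\<parallel>\<close>.\<close>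
    define t where "t = inner (x - p) v / inner v v"
    have "p + t *\<^sub>R v \<in> V" using pV that V(1) by (intro subspace_add subspace_scale)
    from min[OF this] have "(norm (x - p))\<^sup>2 \<le> (norm ((x - p) - t *\<^sub>R v))\<^sup>2"
      by (simp add: algebra_simps)
    also have "\<dots> = (norm (x - p))\<^sup>2 - 2 * t * inner (x - p) v + t\<^sup>2 * inner v v"
      by (simp only: power2_norm_eq_inner inner_diff_left[of "x - p"] inner_diff_right[of _ "x - p"])
         (simp add: inner_commute algebra_simps power2_eq_square)
    also have "\<dots> = (norm (x - p))\<^sup>2 - (inner (x - p) v)\<^sup>2 / inner v v"
      using False by (simp add: t_def power2_eq_square field_simps)
    finally have "(inner (x - p) v)\<^sup>2 / inner v v \<le> 0" by simp
    moreover have "inner v v > 0" using False by simp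
    ultimately have "(inner (x - p) v)\<^sup>2 \<le> 0" by (simp add: divide_le_0_iff)
    thus ?thesis by simp
  qed auto
  with pV show ?thesis by blast
qed

lemma subspace_if_hardy_subspace: "hardy.subspace V \<Longrightarrow> subspace V"
  by (auto simp: hardy.subspace_def subspace_def scaleR_hardy_def)

text \<open>
  The real inner product is the real part of \<^const>\<open>hinner\<close>. Applying the real projection theorem to
  both \<open>v\<close> and \<open>\<i> v\<close> yields orthogonality in the complex sense.
\<close>
lemma hardy_orthogonal_projection:
  assumes V: "hardy.subspace V" "closed V"
  shows "\<exists>p\<in>V. \<forall>v\<in>V. hinner (f - p) v = 0"
proof -
  obtain p where p: "p \<in> V" "\<And>v. v \<in> V \<Longrightarrow> inner (f - p) v = 0"
    using closed_subspace_orthogonal_projection[OF subspace_if_hardy_subspace[OF V(1)] V(2)]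
    by metis
  have "hinner (f - p) v = 0" if "v \<in> V" for v
  proof (rule complex_eqI)
    show "Re (hinner (f - p) v) = Re 0"
      using p(2)[OF that] by (simp add: inner_hardy_def)
    show "Im (hinner (f - p) v) = Im 0"
      using p(2)[OF hardy.subspace_scale[OF V(1) that, of \<i>]]
      by (simp add: inner_hardy_def hinner_scale_right)
  qed
  with p(1) show ?thesis by blast
qed

lemma hardy_proj_in_and_orthogonal:
  assumes V: "hardy.subspace V" "closed V"
  shows "hardy_proj V f \<in> V \<and> (\<forall>h\<in>V. hinner (f - hardy_proj V f) h = 0)"
  unfolding hardy_proj_def
proof (rule theI')
  obtain p where p: "p \<in> V" "\<forall>v\<in>V. hinner (f - p) v = 0"
    using hardy_orthogonal_projection[OF V] by blast
  have "q = p" if q: "q \<in> V" "\<forall>v\<in>V. hinner (f - q) v = 0" for q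
  proof -
    have "q - p \<in> V" using p(1) q(1) V(1) by (intro hardy.subspace_diff)
    hence "hinner (f - p) (q - p) = 0" "hinner (f - q) (q - p) = 0"
      using p(2) q(2) by blast+
    hence "hinner (q - p) (q - p) = 0"
      using hinner_diff_left[of "f - p" "f - q" "q - p"] by simp
    thus ?thesis by (simp add: hinner_same_eq_zero_iff)
  qed
  with p show "\<exists>!g. g \<in> V \<and> (\<forall>h\<in>V. hinner (f - g) h = 0)" by blast
qed

lemma hardy_subspace_ominus: "hardy.subspace M \<Longrightarrow> hardy.subspace (M \<ominus>\<^sub>H K)"
  by (auto simp: hardy.subspace_def hardy_ominus_def hinner_add_left hinner_scale_left)

lemma hardy_subspace_closure:
  assumes "hardy.subspace V"
  shows "hardy.subspace (closure V)"
  unfolding hardy.subspace_def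
proof (intro conjI ballI allI)
  show "0 \<in> closure V"
    using hardy.subspace_0[OF assms] closure_subset by blast
next
  fix f g assume "f \<in> closure V" "g \<in> closure V"
  then obtain x y where "\<And>n. x n \<in> V" "x \<longlonglongrightarrow> f" "\<And>n. y n \<in> V" "y \<longlonglongrightarrow> g"
    unfolding closure_sequential by blast
  thus "f + g \<in> closure V"
    unfolding closure_sequential
    by (intro exI[of _ "\<lambda>n. x n + y n"]) (auto intro: tendsto_add hardy.subspace_add[OF assms])
next
  fix c f assume "f \<in> closure V"
  then obtain x where "\<And>n. x n \<in> V" "x \<longlonglongrightarrow> f"
    unfolding closure_sequential by blast
  thus "c *\<^sub>H f \<in> closure V"
    unfolding closure_sequential
    by (intro exI[of _ "\<lambda>n. c *\<^sub>H x n"])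
       (auto intro: bounded_linear.tendsto[OF bounded_linear_hardy_scale] hardy.subspace_scale[OF assms])
qed

section \<open>Shift-invariant subspaces\<close>

abbreviation hardy_fps :: "hardy \<Rightarrow> complex fps"
  where "hardy_fps f \<equiv> Abs_fps (hcoeff f)"

lemma hcoeff_Mz_funpow: "hcoeff ((hardy_Mz ^^ k) f) n = (if n < k then 0 else hcoeff f (n - k))"
  by (induction k arbitrary: n) (auto simp: hcoeff_Mz split: nat.splits)

lemma hinner_Mz_funpow: "hinner ((hardy_Mz ^^ k) f) ((hardy_Mz ^^ k) g) = hinner f g"
  by (induction k) (auto simp: hinner_Mz)

text \<open>
  Under the hypothesis the \<open>z\<^sup>k f\<close> are pairwise orthogonal with the norm of \<open>f\<close>. Hence the series
  \<open>\<Sum> g\<^sub>k z\<^sup>k f\<close> converges in norm, its sum has norm \<open>\<parallel>g\<parallel> \<parallel>f\<parallel>\<close> by Pythagoras, and comparison of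
  coefficients identifies the sum with the product. Formal power series express this product because
  a product of two elements of \<open>H\<^sup>2\<close> need not lie in \<open>H\<^sup>2\<close>.
\<close>
lemma wandering_product:
  assumes f: "\<And>k. hinner ((hardy_Mz ^^ Suc k) f) f = 0"
  shows "\<exists>h. hardy_fps h = hardy_fps g * hardy_fps f \<and> norm h = norm g * norm f"
proof -
  define x where "x = (\<lambda>k. hcoeff g k *\<^sub>H (hardy_Mz ^^ k) f)"
  have norm_x: "(norm (x k))\<^sup>2 = (cmod (hcoeff g k))\<^sup>2 * (norm f)\<^sup>2" for k
  proof -
    have "norm ((hardy_Mz ^^ k) f) = norm f"
      by (induction k) (auto simp: norm_hardy_Mz)
    thus ?thesis by (simp add: x_def norm_hardy_scale power_mult_distrib)
  qed
  have less0: "hinner ((hardy_Mz ^^ k) f) ((hardy_Mz ^^ j) f) = 0" if "j < k" for j k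
  proof -
    from that obtain i where i: "k = j + Suc i" using less_imp_Suc_add by fastforce
    have "hinner ((hardy_Mz ^^ j) ((hardy_Mz ^^ Suc i) f)) ((hardy_Mz ^^ j) f) = 0"
      using hinner_Mz_funpow[of j "(hardy_Mz ^^ Suc i) f" f] f[of i] by (simp del: funpow.simps)
    thus ?thesis unfolding i by (simp only: funpow_add o_apply)
  qed
  have orth: "pairwise (\<lambda>j k. orthogonal (x j) (x k)) A" for A
  proof (rule pairwiseI)
    fix j k :: nat assume "j \<noteq> k"
    hence "hinner ((hardy_Mz ^^ j) f) ((hardy_Mz ^^ k) f) = 0"
      using less0[of j k] less0[of k j] hinner_commute[of "(hardy_Mz ^^ j) f" "(hardy_Mz ^^ k) f"]
      by (cases "j < k") auto
    thus "orthogonal (x j) (x k)"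
      by (simp add: orthogonal_def inner_hardy_def x_def hinner_scale_left hinner_scale_right)
  qed
  have norm_sum_x: "(norm (\<Sum>k\<in>A. x k))\<^sup>2 = (\<Sum>k\<in>A. (cmod (hcoeff g k))\<^sup>2) * (norm f)\<^sup>2"
    if "finite A" for A
    by (simp add: norm_sum_Pythagorean[OF that orth] norm_x sum_distrib_right)
  have "summable x"
  proof (subst summable_Cauchy, intro allI impI)
    fix e :: real assume "e > 0"
    have "summable (\<lambda>k. (cmod (hcoeff g k))\<^sup>2 * (norm f)\<^sup>2)"
      by (intro summable_mult2 summable_hcoeff)
    then obtain N where N: "\<And>m n. m \<ge> N \<Longrightarrow>
        norm (\<Sum>k=m..<n. (cmod (hcoeff g k))\<^sup>2 * (norm f)\<^sup>2) < e\<^sup>2"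
      using \<open>e > 0\<close> unfolding summable_Cauchy by (metis zero_less_power)
    have "norm (sum x {m..<n}) < e" if "m \<ge> N" for m n
    proof -
      have "(norm (sum x {m..<n}))\<^sup>2 < e\<^sup>2"
        using N[OF that, of n] by (simp add: norm_sum_x flip: sum_distrib_right)
      thus ?thesis using \<open>e > 0\<close> by (simp add: power2_less_imp_less)
    qed
    thus "\<exists>N. \<forall>m\<ge>N. \<forall>n. norm (sum x {m..<n}) < e" by blast
  qed
  define h where "h = suminf x"
  have lim: "(\<lambda>n. \<Sum>k<n. x k) \<longlonglongrightarrow> h"
    unfolding h_def using \<open>summable x\<close> by (rule summable_LIMSEQ)
  have "hardy_fps h = hardy_fps g * hardy_fps f"
  proof (rule fps_ext)
    fix n
    have "hcoeff h n = (\<Sum>k. hcoeff (x k) n)"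
      unfolding h_def by (rule bounded_linear.suminf[OF bounded_linear_hcoeff \<open>summable x\<close>])
    also have "\<dots> = (\<Sum>k\<in>{0..n}. hcoeff (x k) n)"
      by (rule suminf_finite) (auto simp: x_def hcoeff_scale hcoeff_Mz_funpow)
    finally show "fps_nth (hardy_fps h) n = fps_nth (hardy_fps g * hardy_fps f) n"
      by (simp add: fps_mult_nth x_def hcoeff_scale hcoeff_Mz_funpow)
  qed
  moreover have "norm h = norm g * norm f"
  proof -
    have "(\<lambda>n. (norm (\<Sum>k<n. x k))\<^sup>2) \<longlonglongrightarrow> (norm h)\<^sup>2"
      by (intro tendsto_intros lim)
    moreover have "(\<lambda>n. (norm (\<Sum>k<n. x k))\<^sup>2) \<longlonglongrightarrow> (norm g)\<^sup>2 * (norm f)\<^sup>2"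
      unfolding norm_sum_x[OF finite_lessThan] norm_hardy_square[of g]
      by (intro tendsto_mult summable_LIMSEQ summable_hcoeff tendsto_const)
    ultimately have "(norm h)\<^sup>2 = (norm g * norm f)\<^sup>2"
      unfolding power_mult_distrib by (rule LIMSEQ_unique)
    thus ?thesis by simp
  qed
  ultimately show ?thesis by blast
qed

lemma hardy_subspace_Mz_image:
  assumes "hardy.subspace N"
  shows "hardy.subspace (hardy_Mz ` N)"
  unfolding hardy.subspace_def
proof (intro conjI ballI allI)
  show "0 \<in> hardy_Mz ` N"
    using hardy.subspace_0[OF assms] linear_0[OF bounded_linear.linear[OF bounded_linear_hardy_Mz]]
    by (metis image_eqI)
next
  fix f g assume "f \<in> hardy_Mz ` N" "g \<in> hardy_Mz ` N"
  thus "f + g \<in> hardy_Mz ` N"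
    using hardy.subspace_add[OF assms] 
    by (auto simp flip: linear_add[OF bounded_linear.linear[OF bounded_linear_hardy_Mz]])
next
  fix c f assume "f \<in> hardy_Mz ` N"
  thus "c *\<^sub>H f \<in> hardy_Mz ` N"
    using hardy.subspace_scale[OF assms] by (auto simp flip: hardy_Mz_scale)
qed

text \<open>
  Multiplication by \<open>z\<close> is isometric, so it preserves completeness.
\<close>
lemma closed_hardy_Mz_image:
  assumes "hardy.subspace N" "closed N"
  shows "closed (hardy_Mz ` N)"
proof -
  have "complete (hardy_Mz ` N)"
    by (rule complete_isometric_image[where e = 1])
       (use assms in \<open>auto simp: norm_hardy_Mz bounded_linear_hardy_Mz complete_eq_closed
          subspace_if_hardy_subspace\<close>)
  thus ?thesis by (simp add: complete_eq_closed)
qed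

text \<open>
  If \<open>z N = N\<close>, every element of \<open>N\<close> would be divisible by every power of \<open>z\<close>.
\<close>
lemma Mz_image_neq:
  assumes "N \<noteq> {0}" "hardy.subspace N"
  shows "hardy_Mz ` N \<noteq> N"
proof
  assume eq: "hardy_Mz ` N = N"
  have "hcoeff f n = 0" if "f \<in> N" for f n
    using that
  proof (induction n arbitrary: f)
    case 0
    hence "f \<in> hardy_Mz ` N" by (simp add: eq)
    thus ?case by (auto simp: hcoeff_Mz)
  next
    case (Suc n)
    hence "f \<in> hardy_Mz ` N" by (simp add: eq)
    thus ?case using Suc.IH by (auto simp: hcoeff_Mz)
  qed
  hence "N \<subseteq> {0}" using hcoeff_eq_zero_imp by blast
  with assms hardy.subspace_0[OF assms(2)] show False by blast
qed

text \<open>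
  Put \<open>a = \<parallel>f\<parallel>\<close> and \<open>b = \<parallel>g\<parallel>\<close>. For \<open>\<bar>c\<bar> = 1\<close> the elements \<open>f \<plusminus> c g\<close> of \<open>E\<close> have square norm
  \<open>a\<^sup>2 + b\<^sup>2\<close>, and norms are multiplicative on \<open>E\<close>, so \<open>f\<^sup>2 - c\<^sup>2 g\<^sup>2\<close> has norm \<open>a\<^sup>2 + b\<^sup>2\<close>. Taking \<open>c = 1\<close>
  and \<open>c = \<i>\<close>, the parallelogram law for \<open>f\<^sup>2\<close> and \<open>g\<^sup>2\<close> reads
  \<open>2 (a\<^sup>2 + b\<^sup>2)\<^sup>2 = 2 (a\<^sup>4 + b\<^sup>4)\<close>, whence \<open>a b = 0\<close>.
\<close>
lemma wandering_orthogonal_imp_zero: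
  assumes E: "hardy.subspace E" "\<And>f k. f \<in> E \<Longrightarrow> hinner ((hardy_Mz ^^ Suc k) f) f = 0"
    and fg: "f \<in> E" "g \<in> E" "hinner f g = 0" "g \<noteq> 0"
  shows "f = 0"
proof -
  define a b where "a = norm f" and "b = norm g"
  define F G where "F = hardy_fps f" and "G = hardy_fps g"
  have gf: "hinner g f = 0" using fg(3) hinner_commute[of g f] by simp
  have pyth: "(norm (f + c *\<^sub>H g))\<^sup>2 = a\<^sup>2 + b\<^sup>2" if "cmod c = 1" for c
  proof -
    have "orthogonal f (c *\<^sub>H g)"
      using fg(3) by (simp add: orthogonal_def inner_hardy_def hinner_scale_right)
    thus ?thesis
      using that by (simp add: norm_add_Pythagorean norm_hardy_scale a_def b_def)
  qed
  have prod: "\<exists>h. hardy_fps h = F\<^sup>2 - fps_const (c\<^sup>2) * G\<^sup>2 \<and> norm h = a\<^sup>2 + b\<^sup>2"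
    if c: "cmod c = 1" for c
  proof -
    have mem: "f + c *\<^sub>H g \<in> E"
      using fg(1,2) E(1) by (intro hardy.subspace_add hardy.subspace_scale)
    obtain h where h: "hardy_fps h = hardy_fps (f + (- c) *\<^sub>H g) * hardy_fps (f + c *\<^sub>H g)"
      "norm h = norm (f + (- c) *\<^sub>H g) * norm (f + c *\<^sub>H g)"
      using wandering_product[OF E(2)[OF mem]] by blast
    have fps: "hardy_fps (f + d *\<^sub>H g) = F + fps_const d * G" for d
      by (rule fps_ext) (simp add: F_def G_def hcoeff_add hcoeff_scale)
    have "hardy_fps h = F\<^sup>2 - fps_const (c\<^sup>2) * G\<^sup>2"
      unfolding h(1) fps by (simp add: algebra_simps power2_eq_square flip: fps_const_neg)
    moreover have "norm h = a\<^sup>2 + b\<^sup>2"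
    proof -
      have "(norm h)\<^sup>2 = (a\<^sup>2 + b\<^sup>2)\<^sup>2"
        unfolding h(2) power_mult_distrib using pyth[of c] pyth[of "-c"] c
        by (simp add: power2_eq_square)
      thus ?thesis by simp
    qed
    ultimately show ?thesis by blast
  qed
  obtain p where p: "hardy_fps p = F\<^sup>2 - G\<^sup>2" "norm p = a\<^sup>2 + b\<^sup>2"
    using prod[of 1] by auto
  obtain q where q: "hardy_fps q = F\<^sup>2 + G\<^sup>2" "norm q = a\<^sup>2 + b\<^sup>2"
    using prod[of \<i>] by (auto simp flip: fps_const_neg)
  obtain r where r: "hardy_fps r = F * F" "norm r = a * a"
    using wandering_product[OF E(2)[OF fg(1)], of f] by (auto simp: F_def a_def)
  obtain s where s: "hardy_fps s = G * G" "norm s = b * b"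
    using wandering_product[OF E(2)[OF fg(2)], of g] by (auto simp: G_def b_def)
  have "p = r - s" "q = r + s"
    using p(1) q(1) r(1) s(1)
    by (auto intro!: hardy_eqI simp: fps_eq_iff hcoeff_diff hcoeff_add power2_eq_square)
  moreover have "(norm (r - s))\<^sup>2 + (norm (r + s))\<^sup>2 = 2 * (norm r)\<^sup>2 + 2 * (norm s)\<^sup>2"
    by (simp add: power2_norm_eq_inner inner_diff_left inner_diff_right inner_add_left
          inner_add_right)
  ultimately have "(norm p)\<^sup>2 + (norm q)\<^sup>2 = 2 * (norm r)\<^sup>2 + 2 * (norm s)\<^sup>2"
    by simp
  hence "a\<^sup>2 * b\<^sup>2 = 0"
    unfolding p q r s by (simp add: power2_eq_square algebra_simps)
  thus ?thesis using fg(4) by (simp add: a_def b_def)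
qed

text \<open>
  \<open>N\<close> is the orthogonal sum of \<open>z N\<close> and \<open>E = N \<ominus> z N\<close>. The space \<open>E\<close> is nonzero because
  \<open>z N \<noteq> N\<close>, and it is a line because two of its elements that are orthogonal cannot both be nonzero.
\<close>
lemma shift_invariant_decomposition:
  assumes N: "hardy.subspace N" "closed N" "N \<noteq> {0}" "hardy_Mz ` N \<subseteq> N"
  shows "\<exists>u\<in>N. u \<notin> hardy_Mz ` N \<and> (\<forall>f\<in>N. \<exists>c. f - c *\<^sub>H u \<in> hardy_Mz ` N)"
proof -
  let ?Z = "hardy_Mz ` N"
  note Z = hardy_subspace_Mz_image[OF N(1)] closed_hardy_Mz_image[OF N(1,2)]
  define E where "E = N \<ominus>\<^sub>H ?Z"
  have E: "hardy.subspace E"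
    unfolding E_def by (rule hardy_subspace_ominus[OF N(1)])
  have wandering: "hinner ((hardy_Mz ^^ Suc k) f) f = 0" if "f \<in> E" for f k
  proof -
    have "(hardy_Mz ^^ k) f \<in> N"
      using that N(4) by (induction k) (auto simp: E_def hardy_ominus_def)
    hence "hinner f ((hardy_Mz ^^ Suc k) f) = 0"
      using that by (auto simp: E_def hardy_ominus_def)
    thus ?thesis by (subst hinner_commute) (simp del: funpow.simps)
  qed
  have proj: "\<exists>p\<in>?Z. f - p \<in> E" if "f \<in> N" for f
    using hardy_orthogonal_projection[OF Z, of f] hardy.subspace_diff[OF N(1) that] N(4)
    unfolding E_def hardy_ominus_def by blast
  obtain f0 where f0: "f0 \<in> N" "f0 \<notin> ?Z" using Mz_image_neq[OF N(3,1)] N(4) by blast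
  then obtain p0 where p0: "p0 \<in> ?Z" "f0 - p0 \<in> E" using proj by blast
  define u where "u = f0 - p0"
  have u: "u \<in> E" "u \<noteq> 0" using p0 f0 by (auto simp: u_def)
  hence uu: "hinner u u \<noteq> 0" by (simp add: hinner_same_eq_zero_iff)
  have "u \<notin> ?Z" using u uu by (auto simp: E_def hardy_ominus_def)
  moreover have "\<exists>c. f - c *\<^sub>H u \<in> ?Z" if f: "f \<in> N" for f
  proof -
    obtain p where p: "p \<in> ?Z" "f - p \<in> E" using proj[OF f] by blast
    define c where "c = hinner (f - p) u / hinner u u"
    have "f - p - c *\<^sub>H u \<in> E"
      by (rule hardy.subspace_diff[OF E p(2) hardy.subspace_scale[OF E u(1)]])
    moreover have "hinner (f - p - c *\<^sub>H u) u = 0"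
      unfolding hinner_diff_left[of "f - p"] using uu by (simp add: c_def hinner_scale_left)
    ultimately have "f - p - c *\<^sub>H u = 0"
      using wandering_orthogonal_imp_zero[OF E wandering _ u(1) _ u(2)] by blast
    hence "f - c *\<^sub>H u = p" by (simp add: algebra_simps)
    thus ?thesis using p(1) by metis
  qed
  moreover have "u \<in> N" using u by (simp add: E_def hardy_ominus_def)
  ultimately show ?thesis by blast
qed

section \<open>A similarity between the compressed shift and the shift\<close>

definition hardy_backward :: "hardy \<Rightarrow> hardy"
  where "hardy_backward f = (SOME g. \<forall>n. hcoeff g n = hcoeff f (Suc n))"

lemma hcoeff_backward: "hcoeff (hardy_backward f) n = hcoeff f (Suc n)"
proof -
  have "summable (\<lambda>n. (cmod (hcoeff f (Suc n)))\<^sup>2)"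
    by (subst summable_Suc_iff) (rule summable_hcoeff)
  from ex_hardy_hcoeff[OF this]
  have "\<exists>g. \<forall>n. hcoeff g n = hcoeff f (Suc n)" by metis
  from someI_ex[OF this] show ?thesis by (simp add: hardy_backward_def)
qed

lemma norm_hardy_backward: "(norm f)\<^sup>2 = (cmod (hcoeff f 0))\<^sup>2 + (norm (hardy_backward f))\<^sup>2"
  unfolding norm_hardy_square hcoeff_backward
  using suminf_split_head[OF summable_hcoeff[of f]] by simp

lemma norm_hardy_backward_le: "norm (hardy_backward f) \<le> norm f"
  by (rule power2_le_imp_le) (simp_all add: norm_hardy_backward[of f])

lemma bounded_linear_hardy_backward: "bounded_linear hardy_backward"
  by (rule bounded_linear_intro[where K = 1])
     (auto intro!: hardy_eqI simp: hcoeff_backward hcoeff_add hcoeff_scaleR norm_hardy_backward_le)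

text \<open>
  The map \<open>(I - c B) B\<close> with \<open>B\<close> the backward shift; for \<open>c = \<alpha> * cnj \<beta>\<close> it carries \<^const>\<open>S_ab\<close> to
  multiplication by \<open>z\<close>.
\<close>
definition shift_intertwiner :: "complex \<Rightarrow> hardy \<Rightarrow> hardy"
  where "shift_intertwiner c f = hardy_backward f - c *\<^sub>H hardy_backward (hardy_backward f)"

lemma hcoeff_shift_intertwiner: "hcoeff (shift_intertwiner c f) n = hcoeff f (Suc n) - c * hcoeff f (Suc (Suc n))"
  by (simp add: shift_intertwiner_def hcoeff_diff hcoeff_scale hcoeff_backward)

lemma shift_intertwiner_add: "shift_intertwiner c (f + g) = shift_intertwiner c f + shift_intertwiner c g"
  by (rule hardy_eqI) (simp add: hcoeff_shift_intertwiner hcoeff_add algebra_simps)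

lemma shift_intertwiner_scale: "shift_intertwiner c (d *\<^sub>H f) = d *\<^sub>H shift_intertwiner c f"
  by (rule hardy_eqI) (simp add: hcoeff_shift_intertwiner hcoeff_scale algebra_simps)

lemma shift_intertwiner_diff: "shift_intertwiner c (f - g) = shift_intertwiner c f - shift_intertwiner c g"
  by (rule hardy_eqI) (simp add: hcoeff_shift_intertwiner hcoeff_diff algebra_simps)

lemma shift_intertwiner_zero [simp]: "shift_intertwiner c 0 = 0"
  by (rule hardy_eqI) (simp add: hcoeff_shift_intertwiner)

lemma hardy_subspace_shift_intertwiner_vimage:
  "hardy.subspace Z \<Longrightarrow> hardy.subspace (shift_intertwiner c -` Z)"
  unfolding hardy.subspace_def by (auto simp: shift_intertwiner_add shift_intertwiner_scale)

lemma bounded_linear_shift_intertwiner: "bounded_linear (shift_intertwiner c)"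
  unfolding shift_intertwiner_def
  by (intro bounded_linear_sub bounded_linear_hardy_backward
        bounded_linear_compose[OF bounded_linear_hardy_scale]
        bounded_linear_compose[OF bounded_linear_hardy_backward])

lemma norm_shift_intertwiner_ge: "(1 - cmod c) * norm (hardy_backward f) \<le> norm (shift_intertwiner c f)"
proof -
  have "norm (hardy_backward f) - norm (c *\<^sub>H hardy_backward (hardy_backward f)) \<le> norm (shift_intertwiner c f)"
    unfolding shift_intertwiner_def by (rule norm_triangle_ineq2)
  moreover have "norm (c *\<^sub>H hardy_backward (hardy_backward f)) \<le> cmod c * norm (hardy_backward f)"
    unfolding norm_hardy_scale by (intro mult_left_mono norm_hardy_backward_le) auto
  ultimately show ?thesis by (simp add: algebra_simps)
qed

lemma hardy_subspace_H2_ab: "hardy.subspace (H2_ab \<alpha> \<beta>)"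
  unfolding H2_ab_def by (intro hardy_subspace_closure hardy.subspace_span)

lemma closed_H2_ab: "closed (H2_ab \<alpha> \<beta>)"
  by (simp add: H2_ab_def)

lemma H2_ab_generators:
  "\<alpha> *\<^sub>H hardy_monom 0 + \<beta> *\<^sub>H hardy_monom 1 \<in> H2_ab \<alpha> \<beta>"
  "n \<ge> 2 \<Longrightarrow> hardy_monom n \<in> H2_ab \<alpha> \<beta>"
  unfolding H2_ab_def by (auto intro!: subsetD[OF closure_subset] hardy.span_base)

lemma H2_ab_coeff_relation:
  assumes "f \<in> H2_ab \<alpha> \<beta>"
  shows "\<beta> * hcoeff f 0 = \<alpha> * hcoeff f 1"
proof -
  let ?R = "{f. \<beta> * hcoeff f 0 = \<alpha> * hcoeff f 1}"
  have "hardy.subspace ?R"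
    by (auto simp: hardy.subspace_def hcoeff_add hcoeff_scale algebra_simps)
  hence "hardy.span (insert (\<alpha> *\<^sub>H hardy_monom 0 + \<beta> *\<^sub>H hardy_monom 1)
           {hardy_monom n | n. n \<ge> 2}) \<subseteq> ?R"
    by (intro hardy.span_minimal) (auto simp: hcoeff_add hcoeff_scale hcoeff_monom)
  moreover have "closed ?R"
    by (intro closed_Collect_eq continuous_intros linear_continuous_on bounded_linear_hcoeff)
  ultimately show ?thesis
    using assms closure_minimal unfolding H2_ab_def by blast
qed

text \<open>
  The coefficients are found by testing \<open>z f - S f\<close> against the generators: \<open>z\<^sup>n\<close> gives the
  coefficients with index at least 2, and \<open>\<alpha> + \<beta> z\<close> determines the multiple of \<open>\<alpha> + \<beta> z\<close> in
  \<open>S f\<close>.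
\<close>
lemma hcoeff_S_ab:
  assumes norm1: "(cmod \<alpha>)\<^sup>2 + (cmod \<beta>)\<^sup>2 = 1" and "\<alpha> \<noteq> 0"
    and f: "f \<in> H2_ab \<alpha> \<beta>"
  shows "hcoeff (S_ab \<alpha> \<beta> f) 1 = \<alpha> * cnj \<beta> * hcoeff f 1"
    and "n \<ge> 2 \<Longrightarrow> hcoeff (S_ab \<alpha> \<beta> f) n = hcoeff f (n - 1)"
proof -
  define g where "g = S_ab \<alpha> \<beta> f"
  have g: "g \<in> H2_ab \<alpha> \<beta>" "hinner (hardy_Mz f - g) h = 0" if "h \<in> H2_ab \<alpha> \<beta>" for h
    using hardy_proj_in_and_orthogonal[OF hardy_subspace_H2_ab closed_H2_ab] that
    unfolding g_def S_ab_def by blast+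
  show "hcoeff (S_ab \<alpha> \<beta> f) n = hcoeff f (n - 1)" if "n \<ge> 2"
    using g(2)[OF H2_ab_generators(2)[OF that]] that
    by (auto simp: hinner_monom hcoeff_diff hcoeff_Mz g_def split: nat.splits)
  have "- hcoeff g 0 * cnj \<alpha> + (hcoeff f 0 - hcoeff g 1) * cnj \<beta> = 0"
    using g(2)[OF H2_ab_generators(1)]
    by (simp add: hinner_add_right hinner_scale_right hinner_monom hcoeff_diff hcoeff_Mz algebra_simps)
  hence "\<alpha> * hcoeff f 0 * cnj \<beta> = \<alpha> * hcoeff g 0 * cnj \<alpha> + (\<alpha> * hcoeff g 1) * cnj \<beta>"
    by (simp add: algebra_simps)
  also have "\<dots> = hcoeff g 0 * (\<alpha> * cnj \<alpha> + \<beta> * cnj \<beta>)"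
    unfolding H2_ab_coeff_relation[OF g(1)[OF f], symmetric] by (simp add: algebra_simps)
  also have "\<alpha> * cnj \<alpha> + \<beta> * cnj \<beta> = of_real ((cmod \<alpha>)\<^sup>2 + (cmod \<beta>)\<^sup>2)"
    by (simp only: of_real_add complex_norm_square)
  also have "\<dots> = 1" by (simp add: norm1)
  finally have g0: "hcoeff g 0 = \<alpha> * hcoeff f 0 * cnj \<beta>" by simp
  have "\<alpha> * hcoeff g 1 = \<alpha> * cnj \<beta> * (\<beta> * hcoeff f 0)"
    unfolding H2_ab_coeff_relation[OF g(1)[OF f], symmetric] g0 by (simp add: algebra_simps)
  also have "\<dots> = \<alpha> * (\<alpha> * cnj \<beta> * hcoeff f 1)"
    unfolding H2_ab_coeff_relation[OF f] by (simp add: algebra_simps)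
  finally show "hcoeff (S_ab \<alpha> \<beta> f) 1 = \<alpha> * cnj \<beta> * hcoeff f 1"
    using assms(2) by (simp add: g_def)
qed

text \<open>
  The constant term of the left-hand side vanishes because \<open>S\<close> multiplies the coefficient of \<open>z\<close> by
  \<open>\<alpha> * cnj \<beta>\<close> and copies the old one into degree 2. The terms of higher degree agree since \<open>S\<close> shifts
  all coefficients from index 1 on.
\<close>
lemma shift_intertwiner_S_ab:
  assumes "(cmod \<alpha>)\<^sup>2 + (cmod \<beta>)\<^sup>2 = 1" "\<alpha> \<noteq> 0" "f \<in> H2_ab \<alpha> \<beta>"
  shows "shift_intertwiner (\<alpha> * cnj \<beta>) (S_ab \<alpha> \<beta> f) = hardy_Mz (shift_intertwiner (\<alpha> * cnj \<beta>) f)"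
  using hcoeff_S_ab[OF assms]
  by (intro hardy_eqI) (auto simp: hcoeff_shift_intertwiner hcoeff_Mz split: nat.splits)

lemma cmod_product_less_1:
  assumes "(cmod \<alpha>)\<^sup>2 + (cmod \<beta>)\<^sup>2 = 1"
  shows "cmod (\<alpha> * cnj \<beta>) < 1"
  using sum_squares_bound[of "cmod \<alpha>" "cmod \<beta>"] assms by (simp add: norm_mult)

text \<open>
  The relation \<open>\<beta> f\<^sub>0 = \<alpha> f\<^sub>1\<close> makes the constant coefficient lost by the backward shift recoverable:
  it gives \<open>\<bar>\<beta>\<bar> \<parallel>f\<parallel> \<le> \<parallel>B f\<parallel>\<close>. The remaining factor \<open>I - \<alpha> (cnj \<beta>) B\<close> is bounded below since \<open>B\<close> is a
  contraction and \<open>\<bar>\<alpha> (cnj \<beta>)\<bar> < 1\<close>.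
\<close>
lemma norm_le_shift_intertwiner:
  assumes ab: "(cmod \<alpha>)\<^sup>2 + (cmod \<beta>)\<^sup>2 = 1" "\<beta> \<noteq> 0" and f: "f \<in> H2_ab \<alpha> \<beta>"
  shows "(1 - cmod (\<alpha> * cnj \<beta>)) * cmod \<beta> * norm f \<le> norm (shift_intertwiner (\<alpha> * cnj \<beta>) f)"
proof -
  let ?B = "hardy_backward f"
  have "(cmod (\<beta> * hcoeff f 0))\<^sup>2 = (cmod (\<alpha> * hcoeff f 1))\<^sup>2"
    using H2_ab_coeff_relation[OF f] by simp
  also have "\<dots> \<le> (cmod \<alpha>)\<^sup>2 * (norm ?B)\<^sup>2"
    using cmod_hcoeff_le_norm[of ?B 0]
    by (simp add: norm_mult power_mult_distrib hcoeff_backward mult_left_mono)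
  finally have "(cmod \<beta>)\<^sup>2 * (cmod (hcoeff f 0))\<^sup>2 \<le> (cmod \<alpha>)\<^sup>2 * (norm ?B)\<^sup>2"
    by (simp add: norm_mult power_mult_distrib)
  moreover have "(cmod \<alpha>)\<^sup>2 * (norm ?B)\<^sup>2 + (cmod \<beta>)\<^sup>2 * (norm ?B)\<^sup>2 = (norm ?B)\<^sup>2"
    using ab(1) by (simp flip: distrib_right)
  ultimately have "(cmod \<beta> * norm f)\<^sup>2 \<le> (norm ?B)\<^sup>2"
    by (simp add: power_mult_distrib norm_hardy_backward[of f] distrib_left)
  hence "cmod \<beta> * norm f \<le> norm ?B"
    by (rule power2_le_imp_le) simp
  hence "(1 - cmod (\<alpha> * cnj \<beta>)) * (cmod \<beta> * norm f) \<le> (1 - cmod (\<alpha> * cnj \<beta>)) * norm ?B"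
    using cmod_product_less_1[OF ab(1)] by (intro mult_left_mono) auto
  thus ?thesis using norm_shift_intertwiner_ge[of "\<alpha> * cnj \<beta>" f] by (simp add: mult.assoc)
qed

section \<open>Codimension one\<close>

text \<open>
  The component of \<open>v\<close> orthogonal to \<open>K\<close> spans the complement: an element of \<open>M \<ominus> K\<close> differs from a
  multiple of it by a vector that lies both in \<open>K\<close> and in its complement.
\<close>
lemma dim_orthogonal_complement_eq_1:
  assumes K: "hardy.subspace K" "closed K" "K \<subseteq> M" and M: "hardy.subspace M"
    and v: "v \<in> M" "v \<notin> K" "\<And>m. m \<in> M \<Longrightarrow> \<exists>c. m - c *\<^sub>H v \<in> K"
  shows "hardy.dim (M \<ominus>\<^sub>H K) = 1"
proof -
  obtain p where p: "p \<in> K" "\<forall>k\<in>K. hinner (v - p) k = 0"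
    using hardy_orthogonal_projection[OF K(1,2)] by blast
  define w where "w = v - p"
  have w: "w \<in> M \<ominus>\<^sub>H K"
    using p v(1) K(3) M by (auto simp: hardy_ominus_def w_def intro: hardy.subspace_diff)
  have w0: "w \<noteq> 0" using p v(2) by (auto simp: w_def)
  have ominus: "hardy.subspace (M \<ominus>\<^sub>H K)"
    by (rule hardy_subspace_ominus[OF M])
  have "m \<in> hardy.span {w}" if m: "m \<in> M \<ominus>\<^sub>H K" for m
  proof -
    obtain c where c: "m - c *\<^sub>H v \<in> K"
      using v(3) m by (auto simp: hardy_ominus_def)
    have "m - c *\<^sub>H w = (m - c *\<^sub>H v) + c *\<^sub>H p"
      by (simp add: w_def hardy.scale_right_diff_distrib)
    hence "m - c *\<^sub>H w \<in> K"
      using hardy.subspace_add[OF K(1) c hardy.subspace_scale[OF K(1) p(1)]] by metis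
    moreover have "m - c *\<^sub>H w \<in> M \<ominus>\<^sub>H K"
      using m w ominus by (intro hardy.subspace_diff hardy.subspace_scale)
    ultimately have "m - c *\<^sub>H w = 0"
      by (auto simp: hardy_ominus_def simp flip: hinner_same_eq_zero_iff)
    thus ?thesis by (auto simp: hardy.span_singleton)
  qed
  moreover have "hardy.span {w} \<subseteq> M \<ominus>\<^sub>H K"
    using w ominus by (intro hardy.span_minimal) auto
  ultimately have "M \<ominus>\<^sub>H K = hardy.span {w}" by blast
  moreover have "hardy.independent {w}"
    using w0 by simp
  ultimately show ?thesis
    using hardy.dim_span_eq_card_independent[of "{w}"] by simp
qed

theorem theorem4p1:
  fixes \<alpha> \<beta> :: complex and M :: "hardy set"
  assumes "\<alpha> \<noteq> 0" and "\<beta> \<noteq> 0"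
    and "(cmod \<alpha>)\<^sup>2 + (cmod \<beta>)\<^sup>2 = 1"
    and "M \<subseteq> H2_ab \<alpha> \<beta>"
    and "hardy.subspace M" and "closed M" and "M \<noteq> {0}"
    and "S_ab \<alpha> \<beta> ` M \<subseteq> M"
  shows "hardy.dim (M \<ominus>\<^sub>H S_ab \<alpha> \<beta> ` M) = 1"
proof -
  let ?S = "S_ab \<alpha> \<beta>"
  define T where "T = shift_intertwiner (\<alpha> * cnj \<beta>)"
  define d where "d = (1 - cmod (\<alpha> * cnj \<beta>)) * cmod \<beta>"
  have "d > 0"
    using cmod_product_less_1[OF assms(3)] assms(2) by (simp add: d_def)
  have lower: "d * norm f \<le> norm (T f)" if "f \<in> H2_ab \<alpha> \<beta>" for f
    unfolding T_def d_def by (rule norm_le_shift_intertwiner[OF assms(3,2) that])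
  have T_0: "f = 0" if "f \<in> M" "T f = 0" for f
    using lower[of f] that assms(4) \<open>d > 0\<close> by (auto simp: mult_le_0_iff)
  have T_S: "T (?S f) = hardy_Mz (T f)" if "f \<in> M" for f
    unfolding T_def using shift_intertwiner_S_ab[OF assms(3,1)] that assms(4) by blast
  define N where "N = T ` M"
  have N: "hardy.subspace N"
    unfolding hardy.subspace_def N_def
  proof (intro conjI ballI allI)
    show "0 \<in> T ` M"
      using hardy.subspace_0[OF assms(5)] by (force simp: T_def)
  qed (use assms(5) in \<open>auto simp: T_def hardy.subspace_add hardy.subspace_scale
         simp flip: shift_intertwiner_add shift_intertwiner_scale\<close>)
  have "complete N"
    unfolding N_def
    by (rule complete_isometric_image[OF \<open>d > 0\<close>])
       (use assms(4-6) lower in \<open>auto simp: T_def bounded_linear_shift_intertwiner complete_eq_closed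
          subspace_if_hardy_subspace\<close>)
  hence "closed N" by (simp add: complete_eq_closed)
  have "N \<noteq> {0}"
  proof
    assume "N = {0}"
    hence "M \<subseteq> {0}" using T_0 by (auto simp: N_def)
    thus False using assms(7) hardy.subspace_0[OF assms(5)] by blast
  qed
  have Mz_N: "hardy_Mz ` N = T ` ?S ` M"
    unfolding N_def image_image using T_S by (intro image_cong) auto
  hence "hardy_Mz ` N \<subseteq> N"
    using assms(8) by (auto simp: N_def)
  from shift_invariant_decomposition[OF N \<open>closed N\<close> \<open>N \<noteq> {0}\<close> this]
  obtain v where v: "v \<in> M" "T v \<notin> hardy_Mz ` N"
    and dec: "\<And>f. f \<in> M \<Longrightarrow> \<exists>c. T f - c *\<^sub>H T v \<in> hardy_Mz ` N"
    by (auto simp: N_def)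
  \<comment> \<open>Injectivity of \<open>T\<close> on \<open>M\<close> exhibits \<open>S M\<close> as a preimage of the closed set \<open>z N\<close>, hence closed.\<close>
  have SM: "?S ` M = M \<inter> T -` (hardy_Mz ` N)"
  proof (intro subset_antisym subsetI)
    fix f assume f: "f \<in> M \<inter> T -` (hardy_Mz ` N)"
    then obtain g where g: "g \<in> M" "T f = T (?S g)" unfolding Mz_N by auto
    have "f - ?S g \<in> M"
      by (rule hardy.subspace_diff[OF assms(5)]) (use f g(1) assms(8) in auto)
    hence "f - ?S g = 0"
      by (rule T_0) (use g(2) in \<open>auto simp: T_def shift_intertwiner_diff\<close>)
    thus "f \<in> ?S ` M" using g(1) by auto
  next
    fix f assume "f \<in> ?S ` M"
    thus "f \<in> M \<inter> T -` (hardy_Mz ` N)"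
      unfolding Mz_N using assms(8) by blast
  qed
  show ?thesis
  proof (rule dim_orthogonal_complement_eq_1)
    show "hardy.subspace (?S ` M)"
      unfolding SM T_def
      by (intro hardy.subspace_inter assms(5) hardy_subspace_shift_intertwiner_vimage hardy_subspace_Mz_image N)
    show "closed (?S ` M)"
      unfolding SM T_def
      by (intro closed_Int assms(6) closed_vimage closed_hardy_Mz_image N \<open>closed N\<close>
            linear_continuous_on bounded_linear_shift_intertwiner)
    show "\<exists>c. f - c *\<^sub>H v \<in> ?S ` M" if f: "f \<in> M" for f
    proof -
      obtain c where c: "T f - c *\<^sub>H T v \<in> hardy_Mz ` N" using dec[OF f] by blast
      have "f - c *\<^sub>H v \<in> M"
        by (rule hardy.subspace_diff[OF assms(5) f hardy.subspace_scale[OF assms(5) v(1)]])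
      with c show ?thesis
        unfolding SM T_def by (auto simp: shift_intertwiner_diff shift_intertwiner_scale)
    qed
    show "v \<notin> ?S ` M" unfolding SM using v(2) by simp
  qed (use assms(5,8) v(1) in auto)
qed

end
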